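(* Let $\mathfrak{g}=\mathfrak{a}\rtimes\mathfrak{s}$ be a finite-dimensional complex perfect Lie algebra (i.e. $[\mathfrak{g},\mathfrak{g}]=\mathfrak{g}$), where $\mathfrak{s}$ is semisimple and the solvable radical $\mathfrak{a}$ of $\mathfrak{g}$ is nonzero, abelian, and irreducible as an $\mathfrak{s}$-module. Assume that $\mathcal{D}(0,1,1)=0$, where $$\mathcal{D}(0,1,1)=\{\varphi\in\mathrm{End}(\mathfrak{g}) \mid [\varphi(x),y]+[x,\varphi(y)]=0 \text{ for all } x,y\in\mathfrak{g}\}$$ (linear endomorphisms). Then any commutative post-Lie algebra structure on $\mathfrak{g}$ is trivial, i.e., $x\cdot y=0$ for all $x,y\in\mathfrak{g}$.
   Context: A commutative post-Lie algebra structure on a Lie algebra $\mathfrak{g}$ is a bilinear product $\mathfrak{g}\times\mathfrak{g}\to\mathfrak{g}$, $(x,y)\mapsto x\cdot y$, such that for all $x,y,z\in\mathfrak{g}$: $x\cdot y=y\cdot x$; $[x,y]\cdot z=x\cdot(y\cdot z)-y\cdot(x\cdot z)$; $x\cdot[y,z]=[x\cdot y,z]+[y,x\cdot z]$. The $\mathfrak{s}$-module structure on $\mathfrak{a}$ is given by the bracket of $\mathfrak{g}$. *)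

theory Defs
  imports Complex_Main
begin

definition bilinear_map :: "('k::field \<Rightarrow> 'g::ab_group_add \<Rightarrow> 'g) \<Rightarrow> ('g \<Rightarrow> 'g \<Rightarrow> 'g) \<Rightarrow> bool" where
  "bilinear_map scale f \<longleftrightarrow>
     (\<forall>x. Vector_Spaces.linear scale scale (\<lambda>y. f x y)) \<and>
     (\<forall>y. Vector_Spaces.linear scale scale (\<lambda>x. f x y))"

text \<open>The Lie algebra is the whole type \<open>'g\<close>; subalgebras, ideals and modules inside it are sets.\<close>

locale lie_algebra = vector_space scale
  for scale :: "'k::field \<Rightarrow> 'g::ab_group_add \<Rightarrow> 'g" +
  fixes bracket :: "'g \<Rightarrow> 'g \<Rightarrow> 'g" ("[_,/ _]\<^sub>L")
  assumes bilinear_bracket: "bilinear_map scale bracket"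
    and bracket_self: "[x, x]\<^sub>L = 0"
    and jacobi: "[x, [y, z]\<^sub>L]\<^sub>L + [y, [z, x]\<^sub>L]\<^sub>L + [z, [x, y]\<^sub>L]\<^sub>L = 0"
begin

definition bracket_span :: "'g set \<Rightarrow> 'g set \<Rightarrow> 'g set" where
  "bracket_span A B = span {[x, y]\<^sub>L | x y. x \<in> A \<and> y \<in> B}"

definition perfect :: bool where
  "perfect \<longleftrightarrow> bracket_span UNIV UNIV = UNIV"

definition abelian :: "'g set \<Rightarrow> bool" where
  "abelian A \<longleftrightarrow> (\<forall>x\<in>A. \<forall>y\<in>A. [x, y]\<^sub>L = 0)"

definition subalgebra :: "'g set \<Rightarrow> bool" where
  "subalgebra H \<longleftrightarrow> subspace H \<and> (\<forall>x\<in>H. \<forall>y\<in>H. [x, y]\<^sub>L \<in> H)"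

definition ideal_of :: "'g set \<Rightarrow> 'g set \<Rightarrow> bool" where
  "ideal_of H I \<longleftrightarrow> subspace I \<and> I \<subseteq> H \<and> (\<forall>x\<in>H. \<forall>y\<in>I. [x, y]\<^sub>L \<in> I)"

primrec derived_series :: "'g set \<Rightarrow> nat \<Rightarrow> 'g set" where
  "derived_series A 0 = A"
| "derived_series A (Suc n) = bracket_span (derived_series A n) (derived_series A n)"

definition solvable :: "'g set \<Rightarrow> bool" where
  "solvable A \<longleftrightarrow> (\<exists>n. derived_series A n = {0})"

text \<open>\<open>R\<close> is the largest solvable ideal of the subalgebra \<open>H\<close>.\<close>

definition is_solvable_radical :: "'g set \<Rightarrow> 'g set \<Rightarrow> bool" where
  "is_solvable_radical H R \<longleftrightarrow>
     ideal_of H R \<and> solvable R \<and> (\<forall>I. ideal_of H I \<and> solvable I \<longrightarrow> I \<subseteq> R)"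

definition semisimple :: "'g set \<Rightarrow> bool" where
  "semisimple H \<longleftrightarrow> subalgebra H \<and> is_solvable_radical H {0}"

text \<open>The whole algebra is the internal semidirect product of the ideal \<open>A\<close> and the subalgebra \<open>S\<close>.\<close>

definition semidirect_product :: "'g set \<Rightarrow> 'g set \<Rightarrow> bool" where
  "semidirect_product A S \<longleftrightarrow>
     ideal_of UNIV A \<and> subalgebra S \<and> A \<inter> S = {0} \<and> {a + s | a s. a \<in> A \<and> s \<in> S} = UNIV"

text \<open>The action of \<open>S\<close> on \<open>V\<close> is by the bracket.\<close>

definition submodule :: "'g set \<Rightarrow> 'g set \<Rightarrow> bool" where
  "submodule S V \<longleftrightarrow> subspace V \<and> (\<forall>x\<in>S. \<forall>v\<in>V. [x, v]\<^sub>L \<in> V)"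

definition irreducible_module :: "'g set \<Rightarrow> 'g set \<Rightarrow> bool" where
  "irreducible_module S V \<longleftrightarrow>
     submodule S V \<and> V \<noteq> {0} \<and> (\<forall>W. submodule S W \<and> W \<subseteq> V \<longrightarrow> W = {0} \<or> W = V)"

text \<open>The space \<open>\<D>(0,1,1)\<close> of \<open>(\<alpha>,\<beta>,\<gamma>)\<close>-derivations
  \<open>\<alpha> \<phi>([x,y]) = \<beta> [\<phi>(x),y] + \<gamma> [x,\<phi>(y)]\<close> for \<open>(\<alpha>,\<beta>,\<gamma>) = (0,1,1)\<close>.\<close>

definition D011 :: "('g \<Rightarrow> 'g) set" where
  "D011 = {\<phi>. Vector_Spaces.linear scale scale \<phi> \<and> (\<forall>x y. [\<phi> x, y]\<^sub>L + [x, \<phi> y]\<^sub>L = 0)}"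

definition commutative_post_lie :: "('g \<Rightarrow> 'g \<Rightarrow> 'g) \<Rightarrow> bool" where
  "commutative_post_lie p \<longleftrightarrow>
     bilinear_map scale p \<and>
     (\<forall>x y. p x y = p y x) \<and>
     (\<forall>x y z. p [x, y]\<^sub>L z = p x (p y z) - p y (p x z)) \<and>
     (\<forall>x y z. p x [y, z]\<^sub>L = [p x y, z]\<^sub>L + [y, p x z]\<^sub>L)"

end

end

theory Submission
  imports Defs "HOL-Computational_Algebra.Fundamental_Theorem_Algebra"
begin

text \<open>Triviality holds for every perfect \<open>\<gg>\<close>. Write \<open>L x\<close> for multiplication by \<open>x\<close>. The form
  \<open>tr (ad x \<circ> ad (y \<bullet> z))\<close> is symmetric in \<open>y, z\<close> and skew in \<open>x, y\<close>, hence zero; perfectness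
  then gives first \<open>tr (ad x \<circ> L y) = 0\<close> and, using \<open>L [x, y] = ad x \<circ> L y - ad y \<circ> L x\<close>,
  also \<open>tr (L x \<circ> L y) = 0\<close>. The argument of Cartan's criterion now shows that all \<open>L x\<close> are
  nilpotent, and Engel's theorem that the perfect Lie algebra \<open>L \<gg>\<close>, consisting of nilpotent
  operators, is zero.\<close>

section \<open>Generalized eigenspaces and traces\<close>

text \<open>A separate locale, because constants defined in \<open>vector_space\<close> itself are
  shadowed by their instances for \<open>scaleR\<close>.\<close>

locale linear_operators = vector_space scale
  for scale :: "'a::field \<Rightarrow> 'b::ab_group_add \<Rightarrow> 'b" (infixr "*s" 75)
begin

abbreviation endo :: "('b \<Rightarrow> 'b) \<Rightarrow> bool" where
  "endo T \<equiv> Vector_Spaces.linear scale scale T"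

lemma endo_iff: "endo T \<longleftrightarrow> (\<forall>x y. T (x + y) = T x + T y) \<and> (\<forall>c x. T (c *s x) = c *s T x)"
  using Vector_Spaces.linear_iff[of scale scale T] vector_space_axioms by auto

lemma endo_add: "endo T \<Longrightarrow> T (x + y) = T x + T y"
  by (simp add: endo_iff)

lemma endo_scale: "endo T \<Longrightarrow> T (c *s x) = c *s T x"
  by (simp add: endo_iff)

lemma endo_zero: "endo T \<Longrightarrow> T 0 = 0"
  using endo_scale[of T 0 0] by simp

lemma endo_minus: "endo T \<Longrightarrow> T (- x) = - T x"
  using endo_scale[of T "-1" x] by simp

lemma endo_diff: "endo T \<Longrightarrow> T (x - y) = T x - T y"
  using endo_add[of T x "- y"] endo_minus[of T y] by simp

lemma endo_sum: "endo T \<Longrightarrow> T (\<Sum>i\<in>I. f i) = (\<Sum>i\<in>I. T (f i))"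
  by (induction I rule: infinite_finite_induct) (simp_all add: endo_zero endo_add)

lemma endo_comp: "endo S \<Longrightarrow> endo T \<Longrightarrow> endo (\<lambda>x. S (T x))"
  by (simp add: endo_iff)

lemma endo_funpow: "endo T \<Longrightarrow> endo (T ^^ n)"
  by (induction n) (simp_all add: endo_iff)

section \<open>Generalized eigenspaces and their independence\<close>

definition shift :: "('b \<Rightarrow> 'b) \<Rightarrow> 'a \<Rightarrow> 'b \<Rightarrow> 'b" where
  "shift T c v = T v - c *s v"

lemma endo_shift: "endo T \<Longrightarrow> endo (shift T c)"
  by (simp add: endo_iff shift_def scale_right_distrib scale_right_diff_distrib scale_left_commute)

definition geig :: "('b \<Rightarrow> 'b) \<Rightarrow> 'a \<Rightarrow> 'b set" where
  "geig T c = {v. \<exists>k. (shift T c ^^ k) v = 0}"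

lemma funpow_zero_mono:
  assumes "endo T" "(T ^^ k) v = 0" "k \<le> m"
  shows "(T ^^ m) v = 0"
proof -
  have "(T ^^ (m - k + k)) v = 0"
    using assms by (simp only: funpow_add comp_apply endo_zero[OF endo_funpow])
  with assms(3) show ?thesis by simp
qed

lemma subspace_geig:
  assumes "endo T"
  shows "subspace (geig T c)"
proof (rule subspaceI)
  show "0 \<in> geig T c"
    by (auto simp: geig_def intro: exI[of _ 0])
next
  fix x y assume "x \<in> geig T c" "y \<in> geig T c"
  then obtain k m where "(shift T c ^^ k) x = 0" "(shift T c ^^ m) y = 0"
    by (auto simp: geig_def)
  then have "(shift T c ^^ (k + m)) x = 0" "(shift T c ^^ (k + m)) y = 0"
    using funpow_zero_mono[OF endo_shift[OF assms]] by simp_all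
  then show "x + y \<in> geig T c"
    using endo_add[OF endo_funpow[OF endo_shift[OF assms]]] by (auto simp: geig_def intro!: exI[of _ "k + m"])
next
  fix a x assume "x \<in> geig T c"
  then show "a *s x \<in> geig T c"
    using endo_scale[OF endo_funpow[OF endo_shift[OF assms]]] by (auto simp: geig_def)
qed

text \<open>Induction on the exponent that kills the vector: \<open>shift T c\<close> lowers it by
  one. Together with \<open>shift_in_geigD\<close> it spares later proofs all arithmetic with
  exponents.\<close>

lemma geig_induct [consumes 1, case_names zero step]:
  assumes "v \<in> geig T c"
    and "P 0"
    and "\<And>w. w \<in> geig T c \<Longrightarrow> P (shift T c w) \<Longrightarrow> P w"
  shows "P v"
proof -
  from assms(1) obtain k where "(shift T c ^^ k) v = 0"
    by (auto simp: geig_def)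
  then show ?thesis
  proof (induction k arbitrary: v)
    case 0
    then show ?case using assms(2) by simp
  next
    case (Suc k)
    then have "v \<in> geig T c"
      unfolding geig_def by blast
    moreover have "P (shift T c v)"
      using Suc by (simp add: funpow_swap1)
    ultimately show ?case by (rule assms(3))
  qed
qed

lemma shift_in_geigD:
  assumes "shift T c v \<in> geig T c"
  shows "v \<in> geig T c"
proof -
  from assms obtain k where "(shift T c ^^ k) (shift T c v) = 0"
    by (auto simp: geig_def)
  then have "(shift T c ^^ Suc k) v = 0"
    by (simp add: funpow_swap1)
  then show ?thesis
    unfolding geig_def by blast
qed

text \<open>The operators \<open>shift T a\<close> and \<open>shift T c\<close> commute, both being
  polynomials in \<open>T\<close>.\<close>

lemma shift_geig:
  assumes "endo T" "v \<in> geig T c"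
  shows "shift T a v \<in> geig T c"
proof -
  have comm: "shift T c (shift T a w) = shift T a (shift T c w)" for w
    using assms(1) by (simp add: shift_def endo_diff endo_scale scale_right_diff_distrib mult.commute)
  from assms(2) show ?thesis
  proof (induction rule: geig_induct)
    case zero
    show ?case
      using subspace_0[OF subspace_geig[OF assms(1)]] by (simp add: endo_zero[OF endo_shift[OF assms(1)]])
  next
    case (step w)
    then show ?case
      by (metis comm shift_in_geigD)
  qed
qed

text \<open>On an \<open>a\<close>-eigenvector, \<open>shift T c\<close> is multiplication by the
  nonzero scalar \<open>a - c\<close>, yet it is also nilpotent there.\<close>

lemma geig_eq_0_if_shift_eq_0:
  assumes "endo T" "a \<noteq> c" "v \<in> geig T c" "shift T a v = 0"
  shows "v = 0"
  using assms(3,4)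
proof (induction rule: geig_induct)
  case (step w)
  have "shift T c w = (a - c) *s w"
    using step.prems by (simp add: shift_def scale_left_diff_distrib)
  moreover have "shift T a (shift T c w) = 0"
    using \<open>shift T c w = (a - c) *s w\<close> step.prems endo_scale[OF endo_shift[OF assms(1)]] by simp
  ultimately show ?case
    using step assms(2) by simp
qed simp

text \<open>By induction on the exponent for \<open>a\<close>, \<open>shift T a\<close> kills the
  vector, so the previous case of a genuine eigenvector applies.\<close>

lemma geig_Int:
  assumes "endo T" "a \<noteq> c" "v \<in> geig T a" "v \<in> geig T c"
  shows "v = 0"
  using assms(3,4)
proof (induction rule: geig_induct)
  case (step w)
  then have "shift T a w = 0"
    using shift_geig[OF assms(1)] by blast
  then show ?case
    using geig_eq_0_if_shift_eq_0 assms(1,2) step.prems by blast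
qed simp

text \<open>A power of \<open>shift T a\<close> that kills \<open>u a\<close> leaves a shorter
  relation. By induction it kills every other \<open>u b\<close> too, and these then lie in two
  different generalized eigenspaces.\<close>

lemma geig_sum_eq_0:
  assumes "endo T" "finite F" "\<And>c. c \<in> F \<Longrightarrow> u c \<in> geig T c" "(\<Sum>c\<in>F. u c) = 0" "c \<in> F"
  shows "u c = 0"
  using assms(2-5)
proof (induction F arbitrary: u c rule: finite_induct)
  case (insert a F)
  from insert.prems(1) obtain k where k: "(shift T a ^^ k) (u a) = 0"
    by (auto simp: geig_def)
  let ?N = "shift T a ^^ k"
  have N: "endo ?N"
    by (intro endo_funpow endo_shift assms)
  have inv: "(shift T a ^^ j) v \<in> geig T b" if "v \<in> geig T b" for v b j
    using that by (induction j) (simp_all add: shift_geig[OF assms(1)])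
  have "?N (u a + (\<Sum>c\<in>F. u c)) = 0"
    using insert.prems(2) insert.hyps by (simp add: endo_zero[OF N])
  then have "(\<Sum>c\<in>F. ?N (u c)) = 0"
    using k by (simp add: endo_add[OF N] endo_sum[OF N])
  then have "?N (u b) = 0" if "b \<in> F" for b
    using insert.IH[of "\<lambda>c. ?N (u c)" b] inv insert.prems(1) that by blast
  then have F: "u b = 0" if "b \<in> F" for b
    using geig_Int[OF assms(1), of a b "u b"] insert.prems(1)[of b] insert.hyps that
    by (auto simp: geig_def)
  then have "u a = 0"
    using insert.prems(2) insert.hyps by simp
  then show ?case
    using F insert.prems(3) by blast
qed simp

text \<open>On \<open>geig T c\<close>, \<open>shift T a\<close> is the locally nilpotent
  \<open>shift T c\<close> plus the nonzero scalar \<open>c - a\<close>. The induction builds the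
  preimage.\<close>

lemma shift_surj_on_geig:
  assumes "endo T" "a \<noteq> c" "w \<in> geig T c"
  shows "\<exists>u\<in>geig T c. shift T a u = w"
  using assms(3)
proof (induction rule: geig_induct)
  case zero
  show ?case
    using subspace_0[OF subspace_geig[OF assms(1)]] endo_zero[OF endo_shift[OF assms(1)]] by blast
next
  case (step w)
  then obtain u where u: "u \<in> geig T c" "shift T a u = shift T c w"
    by blast
  have "shift T a w - shift T a u = (c - a) *s w"
    unfolding u(2) by (simp add: shift_def scale_left_diff_distrib)
  then have "shift T a (inverse (c - a) *s (w - u)) = w"
    using assms(2) by (simp add: endo_scale[OF endo_shift[OF assms(1)]] endo_diff[OF endo_shift[OF assms(1)]])
  moreover have "inverse (c - a) *s (w - u) \<in> geig T c"
    using subspace_geig[OF assms(1)] step u by (simp add: subspace_scale subspace_diff)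
  ultimately show ?case by blast
qed

text \<open>Up to an error in \<open>geig T a\<close>, each element of the span is
  \<open>shift T a u\<close> with \<open>u\<close> in the span: take a preimage on the components
  for \<open>c \<noteq> a\<close> and 0 on the one for \<open>a\<close>. For
  \<open>shift T a v\<close> this puts \<open>v - u\<close> into \<open>geig T a\<close>. It serves
  to strip linear factors off an annihilating polynomial.\<close>

lemma shift_in_span_geigD:
  assumes "endo T" "shift T a v \<in> span (\<Union>c. geig T c)"
  shows "v \<in> span (\<Union>c. geig T c)"
proof -
  let ?G = "span (\<Union>c. geig T c)"
  have "\<exists>u\<in>?G. w - shift T a u \<in> geig T a" if "w \<in> ?G" for w
    using that
  proof (induction rule: span_induct_alt)
    case base
    then show ?case
      using subspace_0[OF subspace_geig[OF assms(1)]] endo_zero[OF endo_shift[OF assms(1)]] span_zero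
      by (metis diff_0_right)
  next
    case (step b x y)
    then obtain c u where c: "x \<in> geig T c" and u: "u \<in> ?G" "y - shift T a u \<in> geig T a"
      by blast
    have "\<exists>z\<in>?G. x - shift T a z \<in> geig T a"
    proof (cases "c = a")
      case True
      then show ?thesis
        using c span_zero endo_zero[OF endo_shift[OF assms(1)]] by (intro bexI[of _ 0]) auto
    next
      case False
      then obtain z where "z \<in> geig T c" "shift T a z = x"
        using shift_surj_on_geig[OF assms(1) _ c] by metis
      then show ?thesis
        using subspace_0[OF subspace_geig[OF assms(1)]] by (intro bexI[of _ z]) (auto intro: span_base)
    qed
    then obtain z where z: "z \<in> ?G" "x - shift T a z \<in> geig T a"
      by blast
    have "b *s x + y - shift T a (b *s z + u) = b *s (x - shift T a z) + (y - shift T a u)"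
      by (simp add: endo_add[OF endo_shift[OF assms(1)]] endo_scale[OF endo_shift[OF assms(1)]]
          scale_right_diff_distrib)
    then have "b *s x + y - shift T a (b *s z + u) \<in> geig T a"
      using subspace_geig[OF assms(1)] z(2) u(2) by (simp only: subspace_add subspace_scale)
    then show ?case
      using z(1) u(1) by (meson span_add span_scale)
  qed
  then obtain u where u: "u \<in> ?G" "shift T a v - shift T a u \<in> geig T a"
    using assms(2) by blast
  then have "v - u \<in> geig T a"
    by (metis shift_in_geigD endo_diff[OF endo_shift[OF assms(1)]])
  then have "(v - u) + u \<in> ?G"
    using u(1) by (intro span_add) (auto intro: span_base)
  then show ?thesis by simp
qed

text \<open>The Leibniz rule \<open>comm\<close> passes to the shifts by \<open>c + d\<close>,
  \<open>c\<close> and \<open>d\<close>; the nested induction replaces a binomial expansion.\<close>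

lemma geig_bilinear:
  assumes "endo A" "endo S" "endo T"
    and f: "\<And>u. endo (f u)" "\<And>v. endo (\<lambda>u. f u v)"
    and comm: "\<And>u v. A (f u v) = f (S u) v + f u (T v)"
    and "u \<in> geig S c" "v \<in> geig T d"
  shows "f u v \<in> geig A (c + d)"
  using \<open>u \<in> geig S c\<close> \<open>v \<in> geig T d\<close>
proof (induction arbitrary: v rule: geig_induct)
  case zero
  show ?case
    using endo_zero[OF f(2)] subspace_0[OF subspace_geig[OF assms(1)]] by simp
next
  case (step u)
  note IH = step.IH
  from step.prems show ?case
  proof (induction rule: geig_induct)
    case zero
    show ?case
      using endo_zero[OF f(1)] subspace_0[OF subspace_geig[OF assms(1)]] by simp
  next
    case (step v)
    have "shift A (c + d) (f u v) = f (shift S c u) v + f u (shift T d v)"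
      by (simp add: shift_def comm endo_diff[OF f(1)] endo_diff[OF f(2)] endo_scale[OF f(1)]
          endo_scale[OF f(2)] scale_left_distrib algebra_simps)
    also have "\<dots> \<in> geig A (c + d)"
      using IH[OF step.hyps] step.IH by (intro subspace_add subspace_geig assms(1))
    finally show ?case
      by (rule shift_in_geigD)
  qed
qed

section \<open>The trace in a basis\<close>

definition trace :: "'b set \<Rightarrow> ('b \<Rightarrow> 'b) \<Rightarrow> 'a" where
  "trace B T = (\<Sum>b\<in>B. representation B (T b) b)"

lemma trace_add:
  assumes "independent B" "span B = UNIV"
  shows "trace B (\<lambda>v. S v + T v) = trace B S + trace B T"
  using assms by (simp add: trace_def representation_add sum.distrib)

lemma trace_diff:
  assumes "independent B" "span B = UNIV"
  shows "trace B (\<lambda>v. S v - T v) = trace B S - trace B T"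
  using assms by (simp add: trace_def representation_diff sum_subtractf)

lemma trace_scale:
  assumes "independent B" "span B = UNIV"
  shows "trace B (\<lambda>v. c *s T v) = c * trace B T"
  using assms by (simp add: trace_def representation_scale sum_distrib_left)

lemma trace_comp_commute:
  assumes "independent B" "span B = UNIV" "finite B" "endo S" "endo T"
  shows "trace B (\<lambda>v. S (T v)) = trace B (\<lambda>v. T (S v))"
proof -
  have expand: "representation B (P (Q b)) b
      = (\<Sum>c\<in>B. representation B (Q b) c * representation B (P c) b)"
    if "endo P" for P Q b
  proof -
    have "P (Q b) = P (\<Sum>c\<in>B. representation B (Q b) c *s c)"
      using assms by (simp add: sum_representation_eq)
    also have "\<dots> = (\<Sum>c\<in>B. representation B (Q b) c *s P c)"
      by (simp add: endo_sum[OF that] endo_scale[OF that])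
    finally show ?thesis
      using assms by (simp add: representation_sum representation_scale)
  qed
  have "trace B (\<lambda>v. S (T v))
      = (\<Sum>b\<in>B. \<Sum>c\<in>B. representation B (T b) c * representation B (S c) b)"
    unfolding trace_def by (simp add: expand[OF assms(4)])
  also have "\<dots> = (\<Sum>b\<in>B. \<Sum>c\<in>B. representation B (S b) c * representation B (T c) b)"
    by (subst sum.swap) (simp add: mult.commute)
  finally show ?thesis
    unfolding trace_def by (simp add: expand[OF assms(5)])
qed

lemma representation_span_remove:
  assumes "independent B" "v \<in> span (B - {b})"
  shows "representation B v b = 0"
proof -
  have "representation B v = representation (B - {b}) v"
    using assms by (intro representation_extend) auto
  then show ?thesis
    using representation_ne_zero by fastforce
qed

section \<open>Diagonal operators and triangular bases\<close>

definition diag_op :: "'b set \<Rightarrow> ('b \<Rightarrow> 'a) \<Rightarrow> 'b \<Rightarrow> 'b" where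
  "diag_op B d v = (\<Sum>b\<in>B. (d b * representation B v b) *s b)"

lemma endo_diag_op:
  assumes "independent B" "span B = UNIV"
  shows "endo (diag_op B d)"
  using assms by (simp add: endo_iff diag_op_def representation_add representation_scale distrib_left
      scale_left_distrib sum.distrib scale_sum_right mult.left_commute)

lemma diag_op_basis:
  assumes "independent B" "finite B" "b \<in> B"
  shows "diag_op B d b = d b *s b"
proof -
  have "diag_op B d b = (\<Sum>c\<in>B. if c = b then d b *s b else 0)"
    unfolding diag_op_def using assms by (intro sum.cong) (auto simp: representation_basis)
  then show ?thesis
    using assms by simp
qed

text \<open>Grouping the basis vectors by eigenvalue splits \<open>v\<close> into generalized
  eigenvectors; by independence only the part for \<open>c\<close> survives. Thus the operator is
  \<open>g\<close> applied to the semisimple part of \<open>T\<close>, for an arbitrary function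
  \<open>g\<close>.\<close>

lemma diag_op_geig:
  assumes "endo T" "independent B" "span B = UNIV" "finite B"
    and e: "\<And>b. b \<in> B \<Longrightarrow> b \<in> geig T (e b)" and v: "v \<in> geig T c"
  shows "diag_op B (\<lambda>b. g (e b)) v = g c *s v"
proof -
  define w where "w a = (\<Sum>b\<in>{b\<in>B. e b = a}. representation B v b *s b)" for a
  \<comment> \<open>Inserting \<open>c\<close> covers the case that no basis vector belongs to
    \<open>c\<close>; then \<open>w c\<close> is an empty sum and \<open>v\<close> is 0.\<close>
  define F where "F = insert c (e ` B)"
  have F: "finite F" "e ` B \<subseteq> F" "c \<in> F"
    using assms(4) by (auto simp: F_def)
  have w: "w a \<in> geig T a" for a
    unfolding w_def using e subspace_geig[OF assms(1)]
    by (intro subspace_sum subspace_scale) auto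
  have "(\<Sum>a\<in>F. w a) = v"
    unfolding w_def sum.group[OF assms(4) F(1,2)] using assms by (simp add: sum_representation_eq)
  then have "(\<Sum>a\<in>F. w a - (if a = c then v else 0)) = 0"
    using F by (simp add: sum_subtractf)
  moreover have "w a - (if a = c then v else 0) \<in> geig T a" for a
    using w v subspace_geig[OF assms(1)] by (auto simp: subspace_diff)
  ultimately have wa: "w a = (if a = c then v else 0)" if "a \<in> F" for a
    using geig_sum_eq_0[OF assms(1) F(1), of "\<lambda>a. w a - (if a = c then v else 0)" a] that by simp
  have "diag_op B (\<lambda>b. g (e b)) v
      = (\<Sum>a\<in>F. \<Sum>b\<in>{b\<in>B. e b = a}. (g (e b) * representation B v b) *s b)"
    unfolding diag_op_def by (rule sum.group[OF assms(4) F(1,2), symmetric])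
  also have "\<dots> = (\<Sum>a\<in>F. g a *s w a)"
    by (simp add: w_def scale_sum_right)
  also have "\<dots> = (\<Sum>a\<in>F. if a = c then g c *s v else 0)"
    by (intro sum.cong) (auto simp: wa)
  finally show ?thesis
    using F by simp
qed

text \<open>The assumption \<open>T\<close> says that the diagonal entry at \<open>b\<close> is
  \<open>e b\<close>. The diagonal operator preserves \<open>span (B - {b})\<close>, so it just
  multiplies this entry by \<open>d b\<close>.\<close>

lemma trace_diag_op_triangular:
  assumes "independent B" "span B = UNIV" "finite B"
    and T: "\<And>b. b \<in> B \<Longrightarrow> shift T (e b) b \<in> span (B - {b})"
  shows "trace B (\<lambda>v. diag_op B d (T v)) = (\<Sum>b\<in>B. d b * e b)"
  unfolding trace_def
proof (intro sum.cong refl)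
  fix b assume b: "b \<in> B"
  have D: "endo (diag_op B d)"
    by (rule endo_diag_op) fact+
  have "diag_op B d w \<in> span (B - {b})" if "w \<in> span (B - {b})" for w
    using that
  proof (induction rule: span_induct_alt)
    case base
    show ?case by (simp add: endo_zero[OF D] span_zero)
  next
    case (step c x y)
    then have "diag_op B d x \<in> span (B - {b})"
      using diag_op_basis[OF assms(1,3), of x d] by (simp add: span_scale span_base)
    then show ?case
      using step.IH by (simp add: endo_add[OF D] endo_scale[OF D] span_add span_scale)
  qed
  then have "representation B (diag_op B d (shift T (e b) b)) b = 0"
    using assms(1) T[OF b] by (intro representation_span_remove) auto
  moreover have "diag_op B d (T b) = diag_op B d (shift T (e b) b) + (e b * d b) *s b"
    using b assms(1,3) by (simp add: shift_def endo_diff[OF D] endo_scale[OF D] diag_op_basis)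
  ultimately show "representation B (diag_op B d (T b)) b = d b * e b"
    using assms b by (simp add: representation_add representation_scale representation_basis)
qed

section \<open>Polynomials in an operator\<close>

definition poly_op :: "'a poly \<Rightarrow> ('b \<Rightarrow> 'b) \<Rightarrow> 'b \<Rightarrow> 'b" where
  "poly_op q T v = (\<Sum>i\<le>degree q. coeff q i *s (T ^^ i) v)"

lemma poly_op_le:
  assumes "degree q \<le> n"
  shows "poly_op q T v = (\<Sum>i\<le>n. coeff q i *s (T ^^ i) v)"
  unfolding poly_op_def
  by (rule sum.mono_neutral_left) (use assms in \<open>auto simp: coeff_eq_0\<close>)

lemma poly_op_linear_factor_mult:
  assumes "endo T"
  shows "poly_op ([:- a, 1:] * q) T v = poly_op q T (shift T a v)"
proof -
  let ?n = "Suc (degree q)"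
  have deg: "degree ([:- a, 1:] * q) \<le> ?n"
    by (rule order_trans[OF degree_mult_le]) simp
  have pow: "(T ^^ i) (shift T a v) = (T ^^ Suc i) v - a *s (T ^^ i) v" for i
    using assms by (simp add: shift_def endo_diff[OF endo_funpow] endo_scale[OF endo_funpow] funpow_swap1)
  have "poly_op ([:- a, 1:] * q) T v
      = (\<Sum>i\<le>?n. coeff (pCons 0 q) i *s (T ^^ i) v) - (\<Sum>i\<le>?n. (a * coeff q i) *s (T ^^ i) v)"
    unfolding poly_op_le[OF deg] sum_subtractf[symmetric]
    by (intro sum.cong) (simp_all add: scale_left_diff_distrib)
  \<comment> \<open>The term at 0 vanishes because \<open>pCons 0 q\<close> has no constant
    coefficient; in the next sum the top term vanishes, its index exceeding the degree of
    \<open>q\<close>.\<close>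
  also have "(\<Sum>i\<le>?n. coeff (pCons 0 q) i *s (T ^^ i) v) = (\<Sum>i\<le>degree q. coeff q i *s (T ^^ Suc i) v)"
    by (subst sum.atMost_Suc_shift) simp
  also have "(\<Sum>i\<le>?n. (a * coeff q i) *s (T ^^ i) v) = (\<Sum>i\<le>degree q. coeff q i *s (a *s (T ^^ i) v))"
    by (simp add: coeff_eq_0 mult.commute)
  finally show ?thesis
    unfolding poly_op_def pow by (simp add: sum_subtractf scale_right_diff_distrib)
qed

end

section \<open>Decomposition and triangular bases over the complex numbers\<close>

locale complex_fd_space = linear_operators scale + finite_dimensional_vector_space scale Basis
  for scale :: "complex \<Rightarrow> 'b::ab_group_add \<Rightarrow> 'b" (infixr "*s" 75) and Basis
begin

text \<open>The \<open>dimension + 1\<close> iterates of \<open>v\<close> are linearly dependent,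
  and a relation gives the coefficients of \<open>q\<close>.\<close>

lemma ex_annihilating_poly:
  "\<exists>q. q \<noteq> 0 \<and> poly_op q T v = 0"
proof -
  let ?n = dimension
  let ?f = "\<lambda>i. (T ^^ i) v"
  have "\<exists>c. (\<exists>i\<le>?n. c i \<noteq> 0) \<and> (\<Sum>i\<le>?n. c i *s ?f i) = 0"
  proof (cases "inj_on ?f {..?n}")
    case True
    then have "card (?f ` {..?n}) > dim (?f ` {..?n})"
      using dim_subset_UNIV[of "?f ` {..?n}"] by (simp add: card_image)
    then have "dependent (?f ` {..?n})"
      using dependent_biggerset_general by blast
    then obtain u where "\<exists>w\<in>?f ` {..?n}. u w \<noteq> 0" "(\<Sum>w\<in>?f ` {..?n}. u w *s w) = 0"
      by (auto simp: dependent_finite)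
    then show ?thesis
      using True by (intro exI[of _ "\<lambda>i. u (?f i)"]) (auto simp: sum.reindex)
  next
    \<comment> \<open>Dependence of a set does not see repetitions, so two equal iterates are
      treated apart: their difference is the relation.\<close>
    case False
    then obtain i j where ij: "i \<le> ?n" "j \<le> ?n" "i \<noteq> j" "?f i = ?f j"
      by (auto simp: inj_on_def)
    let ?c = "\<lambda>k. if k = i then 1 else if k = j then - 1 else 0"
    have "(\<Sum>k\<le>?n. ?c k *s ?f k) = (\<Sum>k\<le>?n. (if k = i then ?f i else 0) - (if k = j then ?f j else 0))"
      using ij by (intro sum.cong) auto
    also have "\<dots> = 0"
      using ij by (simp add: sum_subtractf)
    finally show ?thesis
      using ij(1) by (intro exI[of _ ?c]) auto
  qed
  then obtain c i where c: "i \<le> ?n" "c i \<noteq> 0" "(\<Sum>i\<le>?n. c i *s ?f i) = 0"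
    by blast
  define q where "q = (\<Sum>i\<le>?n. monom (c i) i)"
  have coeff: "coeff q k = (if k \<le> ?n then c k else 0)" for k
    by (simp add: q_def coeff_sum coeff_monom)
  then have "degree q \<le> ?n"
    by (intro degree_le) simp
  then have "poly_op q T v = 0"
    using c(3) by (simp add: poly_op_le coeff)
  moreover have "q \<noteq> 0"
    using coeff[of i] c by auto
  ultimately show ?thesis by blast
qed

text \<open>A root \<open>a\<close> of \<open>q\<close> exists over the complex numbers. The
  cofactor of its linear factor annihilates \<open>shift T a v\<close>, and
  \<open>shift_in_span_geigD\<close> leads back to \<open>v\<close>.\<close>

lemma annihilated_in_span_geig:
  assumes "endo T"
  shows "q \<noteq> 0 \<Longrightarrow> poly_op q T v = 0 \<Longrightarrow> v \<in> span (\<Union>c. geig T c)"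
proof (induction "degree q" arbitrary: q v)
  case 0
  then obtain a where "q = [:a:]" "a \<noteq> 0"
    by (metis degree_eq_zeroE pCons_0_0)
  then show ?case
    using 0 by (simp add: poly_op_def span_zero)
next
  case (Suc n)
  then obtain a where "poly q a = 0"
    using fundamental_theorem_of_algebra[of q] by (auto simp: constant_degree)
  then obtain r where r: "q = [:- a, 1:] * r"
    using poly_eq_0_iff_dvd by blast
  then have "r \<noteq> 0" "degree r = n"
    using Suc by (auto simp: degree_mult_eq simp del: mult_pCons_left)
  then have "shift T a v \<in> span (\<Union>c. geig T c)"
    using Suc r poly_op_linear_factor_mult[OF assms] by metis
  then show ?case
    by (rule shift_in_span_geigD[OF assms])
qed

lemma span_geig:
  assumes "endo T"
  shows "span (\<Union>c. geig T c) = UNIV"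
proof -
  have "v \<in> span (\<Union>c. geig T c)" for v
    using ex_annihilating_poly[of T v] annihilated_in_span_geig[OF assms] by metis
  then show ?thesis
    by auto
qed

text \<open>The basis grows along the filtration by kernels of powers, for all eigenvalues at once.
  A vector new at stage \<open>j + 1\<close> is sent by its shift into the span of the earlier ones,
  so no order on the basis is recorded.\<close>

lemma triangular_basis_of_kernels:
  assumes "endo T"
  shows "\<exists>B. independent B \<and> span B = span (\<Union>c. {v. (shift T c ^^ j) v = 0}) \<and>
    (\<forall>b\<in>B. \<exists>c. b \<in> geig T c \<and> shift T c b \<in> span (B - {b}))"
proof (induction j)
  case 0
  show ?case
    by (rule exI[of _ "{}"]) (simp add: independent_empty span_zero)
next
  case (Suc j)
  let ?K = "\<lambda>j. \<Union>c. {v. (shift T c ^^ j) v = 0}"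
  from Suc.IH obtain B where B: "independent B" "span B = span (?K j)"
    "\<forall>b\<in>B. \<exists>c. b \<in> geig T c \<and> shift T c b \<in> span (B - {b})"
    by (elim exE conjE)
  have "(shift T c ^^ Suc j) v = 0" if "(shift T c ^^ j) v = 0" for c v
    using that endo_zero[OF endo_shift[OF assms]] by simp
  then have KK: "?K j \<subseteq> ?K (Suc j)"
    by blast
  have BK: "B \<subseteq> span (?K (Suc j))"
    using span_superset[of B] span_mono[OF KK] unfolding B(2) by (rule subset_trans)
  obtain B' where B': "B \<subseteq> B'" "B' \<subseteq> B \<union> ?K (Suc j)" "independent B'" "B \<union> ?K (Suc j) \<subseteq> span B'"
    using maximal_independent_subset_extend[OF Un_upper1 B(1)] by blast
  have "span B' = span (?K (Suc j))"
  proof (intro subset_antisym span_minimal subspace_span)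
    show "B' \<subseteq> span (?K (Suc j))"
      using B'(2) BK span_superset[of "?K (Suc j)"] by (meson Un_least subset_trans)
    show "?K (Suc j) \<subseteq> span B'"
      using B'(4) by simp
  qed
  moreover have "\<exists>c. b \<in> geig T c \<and> shift T c b \<in> span (B' - {b})" if "b \<in> B'" for b
  proof (cases "b \<in> B")
    case True
    moreover have "span (B - {b}) \<subseteq> span (B' - {b})"
      using B'(1) by (intro span_mono) blast
    ultimately show ?thesis using B(3) by blast
  next
    case False
    then have "b \<in> ?K (Suc j)"
      using that B'(2) by blast
    then obtain c where c: "(shift T c ^^ Suc j) b = 0"
      by blast
    then have "(shift T c ^^ j) (shift T c b) = 0"
      by (simp add: funpow_swap1)
    then have "shift T c b \<in> span B"
      unfolding B(2) by (intro span_base) blast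
    also have "\<dots> \<subseteq> span (B' - {b})"
      using B'(1) False by (intro span_mono) blast
    finally show ?thesis
      using c unfolding geig_def by blast
  qed
  ultimately show ?case
    using B'(3) by (intro exI[of _ B'] conjI ballI)
qed

lemma triangular_basis:
  assumes "endo T"
  obtains B e where "independent B" "span B = UNIV" "\<And>b. b \<in> B \<Longrightarrow> b \<in> geig T (e b)"
    "\<And>b. b \<in> B \<Longrightarrow> shift T (e b) b \<in> span (B - {b})"
proof -
  \<comment> \<open>\<open>C\<close> only serves to bound the exponents: it is a finite basis of
    generalized eigenvectors, so the kernel filtration reaches the whole space at the maximum
    \<open>j\<close>.\<close>
  obtain C where C: "C \<subseteq> (\<Union>c. geig T c)" "independent C" "(\<Union>c. geig T c) \<subseteq> span C"
    using maximal_independent_subset by blast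
  then have "span C = UNIV"
    using span_geig[OF assms] by (metis span_minimal subspace_span top.extremum_uniqueI)
  have "\<forall>b\<in>C. \<exists>k c. (shift T c ^^ k) b = 0"
    using C(1) unfolding geig_def by blast
  then obtain k where k: "\<forall>b\<in>C. \<exists>c. (shift T c ^^ k b) b = 0"
    by metis
  define j where "j = Max (k ` C)"
  have "k b \<le> j" if "b \<in> C" for b
    using finiteI_independent[OF C(2)] that by (simp add: j_def)
  then have "\<exists>c. (shift T c ^^ j) b = 0" if "b \<in> C" for b
    using k that funpow_zero_mono[OF endo_shift[OF assms]] by blast
  then have "C \<subseteq> (\<Union>c. {v. (shift T c ^^ j) v = 0})"
    by blast
  then have "span (\<Union>c. {v. (shift T c ^^ j) v = 0}) = UNIV"
    using span_mono \<open>span C = UNIV\<close> by (metis top.extremum_uniqueI)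
  then obtain B where B: "independent B" "span B = UNIV"
    "\<forall>b\<in>B. \<exists>c. b \<in> geig T c \<and> shift T c b \<in> span (B - {b})"
    using triangular_basis_of_kernels[OF assms, of j] by metis
  from B(3) obtain e where "\<forall>b\<in>B. b \<in> geig T (e b) \<and> shift T (e b) b \<in> span (B - {b})"
    by metis
  with B show thesis
    using that[of B e] by blast
qed

end

section \<open>Engel's theorem\<close>

locale complex_fd_lie_algebra = lie_algebra scale bracket + complex_fd_space scale Basis
  for scale :: "complex \<Rightarrow> 'g::ab_group_add \<Rightarrow> 'g" (infixr "*s" 75)
    and bracket :: "'g \<Rightarrow> 'g \<Rightarrow> 'g" ("[_,/ _]\<^sub>L") and Basis
begin

section \<open>Rules for the bracket, and tools for perfectness and dimension\<close>

lemma endo_bracket: "endo (\<lambda>y. [x, y]\<^sub>L)" "endo (\<lambda>x. [x, y]\<^sub>L)"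
  using bilinear_bracket by (auto simp: bilinear_map_def)

lemmas bracket_simps =
  endo_add[OF endo_bracket(1)] endo_add[OF endo_bracket(2)]
  endo_scale[OF endo_bracket(1)] endo_scale[OF endo_bracket(2)]
  endo_zero[OF endo_bracket(1)] endo_zero[OF endo_bracket(2)]
  endo_minus[OF endo_bracket(1)] endo_minus[OF endo_bracket(2)]
  endo_diff[OF endo_bracket(1)] endo_diff[OF endo_bracket(2)]

lemma bracket_skew: "[y, x]\<^sub>L = - [x, y]\<^sub>L"
proof -
  have "[x + y, x + y]\<^sub>L = [x, y]\<^sub>L + [y, x]\<^sub>L"
    by (simp only: bracket_simps) (simp add: bracket_self)
  then show ?thesis
    by (simp add: bracket_self eq_neg_iff_add_eq_0 add.commute)
qed

lemma bracket_bracket_left: "[[x, y]\<^sub>L, z]\<^sub>L = [x, [y, z]\<^sub>L]\<^sub>L - [y, [x, z]\<^sub>L]\<^sub>L"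
  using jacobi[of x y z] bracket_skew[of z "[x, y]\<^sub>L"] bracket_skew[of x z]
  by (simp add: bracket_simps algebra_simps)

lemma bracket_bracket_right: "[x, [y, z]\<^sub>L]\<^sub>L = [[x, y]\<^sub>L, z]\<^sub>L + [y, [x, z]\<^sub>L]\<^sub>L"
  by (simp add: bracket_bracket_left)

lemma perfect_induct [consumes 1, case_names subspace bracket]:
  assumes perfect "subspace {x. P x}" "\<And>x y. P [x, y]\<^sub>L"
  shows "P x"
proof -
  have "span {[x, y]\<^sub>L | x y. x \<in> UNIV \<and> y \<in> UNIV} \<subseteq> {x. P x}"
    using assms by (intro span_minimal) auto
  then show ?thesis
    using assms(1) by (auto simp: perfect_def bracket_span_def)
qed

text \<open>Choosing a subspace of maximal dimension takes the place of induction on dimension in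
  Engel's theorem.\<close>

lemma ex_max_dim:
  assumes "Q V"
  shows "\<exists>M. Q M \<and> (\<forall>V'. Q V' \<longrightarrow> dim V' \<le> dim M)"
  using ex_has_greatest_nat[of Q V dim "Suc dimension"] assms dim_subset_UNIV
  by (metis less_Suc_eq_le)

lemma dim_less_span_insert:
  assumes "subspace V" "y \<notin> V"
  shows "dim V < dim (span (insert y V))"
proof (rule dim_psubset)
  have "y \<in> span (insert y V)" "V \<subseteq> span (insert y V)"
    using span_superset by blast+
  then show "span V \<subset> span (span (insert y V))"
    using assms by (auto simp: span_eq_iff[THEN iffD2])
qed

lemma span_insert_subspace:
  assumes "subspace V"
  shows "span (insert y V) = {v + c *s y | v c. v \<in> V}"
proof (intro subset_antisym subsetI)
  fix u assume "u \<in> span (insert y V)"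
  moreover have "span V = V"
    using assms by simp
  ultimately obtain c where "u - c *s y \<in> V"
    by (auto simp: span_insert)
  moreover have "u = (u - c *s y) + c *s y"
    by simp
  ultimately show "u \<in> {v + c *s y | v c. v \<in> V}"
    by blast
next
  fix u assume "u \<in> {v + c *s y | v c. v \<in> V}"
  then show "u \<in> span (insert y V)"
    by (auto intro!: span_add span_scale intro: span_base)
qed

text \<open>Engel's theorem for the action on \<open>\<gg>/K\<close>, with subspaces between \<open>K\<close> and \<open>\<gg>\<close> in place
  of quotient spaces: a subalgebra with this property has a common zero on every subquotient.\<close>

definition engel_mod :: "'g set \<Rightarrow> 'g set \<Rightarrow> bool" where
  "engel_mod K H \<longleftrightarrow> (\<forall>U W. submodule H U \<and> submodule H W \<and> K \<subseteq> U \<and> U \<subset> W \<longrightarrow>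
     (\<exists>w\<in>W - U. \<forall>h\<in>H. [h, w]\<^sub>L \<in> U))"

text \<open>Start from a \<open>w\<close> outside \<open>U\<close> that \<open>H\<close> sends into
  \<open>U\<close> and apply \<open>ad y\<close> repeatedly. The iterates reach
  \<open>K \<subseteq> U\<close>; the last one outside \<open>U\<close> is sent into
  \<open>U\<close> by \<open>y\<close> as well.\<close>

lemma engel_mod_extend:
  assumes H: "subspace H" "engel_mod K H" and y: "\<And>h. h \<in> H \<Longrightarrow> [h, y]\<^sub>L \<in> H"
    and nil: "\<And>x. \<exists>k. ((\<lambda>z. [y, z]\<^sub>L) ^^ k) x \<in> K"
  shows "engel_mod K (span (insert y H))"
  unfolding engel_mod_def
proof (intro allI impI, elim conjE)
  fix U W
  let ?H = "span (insert y H)" and ?ad = "\<lambda>z. [y, z]\<^sub>L"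
  assume U: "submodule ?H U" and W: "submodule ?H W" and KU: "K \<subseteq> U" and UW: "U \<subset> W"
  have HH: "H \<subseteq> ?H" and yH: "y \<in> ?H"
    using span_superset by blast+
  then have "submodule H U" "submodule H W"
    using U W unfolding submodule_def by blast+
  then obtain w where w: "w \<in> W" "w \<notin> U" "\<forall>h\<in>H. [h, w]\<^sub>L \<in> U"
    using H(2) KU UW unfolding engel_mod_def by (metis DiffE)
  \<comment> \<open>\<open>ad y\<close> preserves the vectors that \<open>H\<close> sends into
    \<open>U\<close>, because \<open>y\<close> normalizes \<open>H\<close>.\<close>
  have iter: "(?ad ^^ j) w \<in> W \<and> (\<forall>h\<in>H. [h, (?ad ^^ j) w]\<^sub>L \<in> U)" for j
  proof (induction j)
    case (Suc j)
    let ?w = "(?ad ^^ j) w"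
    have "[h, [y, ?w]\<^sub>L]\<^sub>L \<in> U" if "h \<in> H" for h
    proof -
      have "[[h, y]\<^sub>L, ?w]\<^sub>L \<in> U" "[y, [h, ?w]\<^sub>L]\<^sub>L \<in> U"
        using Suc y[OF that] that U yH by (auto simp: submodule_def)
      then show ?thesis
        using U unfolding bracket_bracket_right[of h y] submodule_def by (simp add: subspace_add)
    qed
    then show ?case
      using Suc W yH by (auto simp: submodule_def)
  qed (use w in simp)
  define k where "k = (LEAST k. (?ad ^^ k) w \<in> U)"
  have "\<exists>k. (?ad ^^ k) w \<in> U"
    using nil[of w] KU by blast
  then have k: "(?ad ^^ k) w \<in> U"
    unfolding k_def by (rule LeastI_ex)
  with w(2) obtain j where j: "k = Suc j"
    by (cases k) auto
  then have "(?ad ^^ j) w \<notin> U"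
    using not_less_Least[of j "\<lambda>k. (?ad ^^ k) w \<in> U"] by (simp add: k_def)
  moreover have "[h, (?ad ^^ j) w]\<^sub>L \<in> U" if "h \<in> ?H" for h
  proof -
    from that obtain v c where h: "h = v + c *s y" "v \<in> H"
      by (auto simp: span_insert_subspace[OF H(1)])
    have "[v, (?ad ^^ j) w]\<^sub>L \<in> U" "[y, (?ad ^^ j) w]\<^sub>L \<in> U" "subspace U"
      using iter[of j] h(2) k U by (simp_all add: j submodule_def)
    then show ?thesis
      unfolding h(1) by (simp add: bracket_simps subspace_add subspace_scale)
  qed
  ultimately show "\<exists>w\<in>W - U. \<forall>h\<in>?H. [h, w]\<^sub>L \<in> U"
    using iter[of j] by blast
qed

text \<open>Take a subalgebra \<open>H\<close> of maximal dimension with the property. If it is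
  proper, the property for the pair \<open>H \<subset> UNIV\<close> yields a \<open>y\<close>
  outside \<open>H\<close> normalizing \<open>H\<close>, and adjoining \<open>y\<close> contradicts
  maximality.\<close>

lemma engel_mod_UNIV:
  assumes K: "ideal_of UNIV K" and nil: "\<And>x y. \<exists>k. ((\<lambda>z. [x, z]\<^sub>L) ^^ k) y \<in> K"
  shows "engel_mod K UNIV"
proof -
  let ?Q = "\<lambda>H. subalgebra H \<and> K \<subseteq> H \<and> engel_mod K H"
  \<comment> \<open>The ideal \<open>K\<close> starts the search: it acts as zero modulo
    itself.\<close>
  have "[x, w]\<^sub>L \<in> K" if "x \<in> K" for x w
    using K that bracket_skew[of x w] unfolding ideal_of_def by (simp add: subspace_neg)
  then have "engel_mod K K"
    unfolding engel_mod_def by blast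
  moreover have "subalgebra K"
    using K by (simp add: ideal_of_def subalgebra_def)
  ultimately have "?Q K"
    by simp
  then have "\<exists>M. ?Q M \<and> (\<forall>V. ?Q V \<longrightarrow> dim V \<le> dim M)"
    by (rule ex_max_dim)
  then obtain H where "?Q H \<and> (\<forall>V. ?Q V \<longrightarrow> dim V \<le> dim H)"
    by (rule exE)
  then have H: "?Q H" and max: "\<And>V. ?Q V \<Longrightarrow> dim V \<le> dim H"
    by simp_all
  have sub: "subspace H" "\<And>x y. x \<in> H \<Longrightarrow> y \<in> H \<Longrightarrow> [x, y]\<^sub>L \<in> H"
    using H by (auto simp: subalgebra_def)
  have "H = UNIV"
  proof (rule ccontr)
    assume "H \<noteq> UNIV"
    moreover have "submodule H H" "submodule H UNIV"
      using sub by (auto simp: submodule_def)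
    ultimately obtain y where y: "y \<notin> H" "\<And>h. h \<in> H \<Longrightarrow> [h, y]\<^sub>L \<in> H"
      using H unfolding engel_mod_def by (metis DiffE psubsetI subset_UNIV)
    let ?H = "span (insert y H)"
    have y': "[y, h]\<^sub>L \<in> H" if "h \<in> H" for h
      using y(2)[OF that] sub(1) bracket_skew[of y h] by (simp add: subspace_neg)
    have HH: "H \<subseteq> ?H"
      using span_superset by blast
    have "[u, v]\<^sub>L \<in> H" if "u \<in> ?H" "v \<in> ?H" for u v
    proof -
      from that obtain a b c d where uv: "u = a + c *s y" "v = b + d *s y" "a \<in> H" "b \<in> H"
        by (auto simp: span_insert_subspace[OF sub(1)])
      have "[u, v]\<^sub>L = ([a, b]\<^sub>L + c *s [y, b]\<^sub>L) + d *s [a, y]\<^sub>L"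
        by (simp add: uv bracket_simps bracket_self)
      also have "\<dots> \<in> H"
        using uv sub y(2) y' by (simp add: subspace_add subspace_scale)
      finally show ?thesis .
    qed
    then have "subalgebra ?H"
      using HH unfolding subalgebra_def by blast
    moreover have "engel_mod K ?H"
      using engel_mod_extend H sub(1) y(2) nil by blast
    ultimately have "dim ?H \<le> dim H"
      using max H HH by blast
    then show False
      using dim_less_span_insert[OF sub(1) y(1)] by simp
  qed
  then show ?thesis
    using H by simp
qed

text \<open>In a proper ideal \<open>Z\<close> of maximal dimension containing \<open>K\<close>,
  Engel's theorem gives \<open>w\<close> outside \<open>Z\<close> with all
  \<open>[x, w]\<^sub>L\<close> in \<open>Z\<close>. Then \<open>Z\<close> and \<open>w\<close> span
  an ideal, hence everything, so all brackets lie in \<open>Z\<close>, against perfectness.\<close>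

lemma perfect_ad_nilpotent_mod_ideal:
  assumes perfect and K: "ideal_of UNIV K" and nil: "\<And>x y. \<exists>k. ((\<lambda>z. [x, z]\<^sub>L) ^^ k) y \<in> K"
  shows "K = UNIV"
proof (rule ccontr)
  assume "K \<noteq> UNIV"
  let ?Q = "\<lambda>Z. submodule UNIV Z \<and> K \<subseteq> Z \<and> Z \<noteq> UNIV"
  have "?Q K"
    using K \<open>K \<noteq> UNIV\<close> by (auto simp: ideal_of_def submodule_def)
  then have "\<exists>M. ?Q M \<and> (\<forall>V. ?Q V \<longrightarrow> dim V \<le> dim M)"
    by (rule ex_max_dim)
  then obtain Z where "?Q Z \<and> (\<forall>V. ?Q V \<longrightarrow> dim V \<le> dim Z)"
    by (rule exE)
  then have Z: "?Q Z" and max: "\<And>V. ?Q V \<Longrightarrow> dim V \<le> dim Z"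
    by simp_all
  have sub: "subspace Z" "\<And>x z. z \<in> Z \<Longrightarrow> [x, z]\<^sub>L \<in> Z"
    using Z by (auto simp: submodule_def)
  have "submodule UNIV UNIV"
    by (simp add: submodule_def)
  then obtain w where w: "w \<notin> Z" "\<And>x. [x, w]\<^sub>L \<in> Z"
    using engel_mod_UNIV[OF K nil] Z unfolding engel_mod_def by (metis DiffE UNIV_I psubsetI subset_UNIV)
  have into_Z: "[x, v]\<^sub>L \<in> Z" if "v \<in> span (insert w Z)" for x v
  proof -
    from that obtain z c where "v = z + c *s w" "z \<in> Z"
      by (auto simp: span_insert_subspace[OF sub(1)])
    then show ?thesis
      using sub w by (simp add: bracket_simps subspace_add subspace_scale)
  qed
  have ZZ: "Z \<subseteq> span (insert w Z)"
    using span_superset by blast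
  then have "submodule UNIV (span (insert w Z))"
    using into_Z by (auto simp: submodule_def)
  then have "span (insert w Z) = UNIV"
    using max[of "span (insert w Z)"] dim_less_span_insert[OF sub(1) w(1)] Z ZZ by fastforce
  then have brackets: "[x, y]\<^sub>L \<in> Z" for x y
    using into_Z by simp
  have "x \<in> Z" for x
    by (rule perfect_induct[OF assms(1), of "\<lambda>x. x \<in> Z"]) (simp_all add: sub(1) brackets)
  then show False
    using Z by blast
qed

end

section \<open>Trace forms and nilpotency\<close>

locale perfect_cpa = complex_fd_lie_algebra scale bracket Basis
  for scale :: "complex \<Rightarrow> 'g::ab_group_add \<Rightarrow> 'g" (infixr "*s" 75)
    and bracket :: "'g \<Rightarrow> 'g \<Rightarrow> 'g" ("[_,/ _]\<^sub>L") and Basis +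
  fixes p :: "'g \<Rightarrow> 'g \<Rightarrow> 'g" (infixl "\<bullet>" 70)
  assumes perfect: perfect and cpa: "commutative_post_lie p"
begin

section \<open>Identities of the product\<close>

lemma endo_prod: "endo (\<lambda>y. x \<bullet> y)" "endo (\<lambda>x. x \<bullet> y)"
  using cpa by (auto simp: commutative_post_lie_def bilinear_map_def)

lemmas endo_ops = endo_bracket endo_prod

lemmas bilinear_simps = bracket_simps
  endo_add[OF endo_prod(1)] endo_add[OF endo_prod(2)]
  endo_scale[OF endo_prod(1)] endo_scale[OF endo_prod(2)]
  endo_zero[OF endo_prod(1)] endo_zero[OF endo_prod(2)]
  endo_minus[OF endo_prod(1)] endo_minus[OF endo_prod(2)]
  endo_diff[OF endo_prod(1)] endo_diff[OF endo_prod(2)]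

lemma prod_commute: "x \<bullet> y = y \<bullet> x"
  using cpa by (auto simp: commutative_post_lie_def)

lemma prod_bracket_left: "[x, y]\<^sub>L \<bullet> z = x \<bullet> (y \<bullet> z) - y \<bullet> (x \<bullet> z)"
  using cpa by (auto simp: commutative_post_lie_def)

lemma prod_bracket_right: "x \<bullet> [y, z]\<^sub>L = [x \<bullet> y, z]\<^sub>L + [y, x \<bullet> z]\<^sub>L"
  using cpa by (auto simp: commutative_post_lie_def)

text \<open>Commutativity turns the derivation rule for \<open>L z\<close> into a second formula for
  \<open>L [x, y]\<close>, mixing \<open>ad\<close> and \<open>L\<close>.\<close>

lemma prod_bracket_left': "[x, y]\<^sub>L \<bullet> z = [x, y \<bullet> z]\<^sub>L - [y, x \<bullet> z]\<^sub>L"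
  using prod_bracket_right[of z x y] bracket_skew[of "x \<bullet> z" y]
  by (simp add: prod_commute[of _ z])

section \<open>Vanishing trace forms, for an arbitrary basis\<close>

context
  fixes B assumes B: "independent B" "span B = UNIV"
begin

lemma fin_B: "finite B"
  using finiteI_independent B by blast

lemmas tr_add = trace_add[OF B]
lemmas tr_diff = trace_diff[OF B]
lemmas tr_scale = trace_scale[OF B]
lemmas tr_commute = trace_comp_commute[OF B fin_B]

abbreviation "tr \<equiv> trace B"

text \<open>As \<open>L z\<close> is a derivation, \<open>ad (z \<bullet> x)\<close> is the
  commutator of \<open>L z\<close> and \<open>ad x\<close>; cyclicity of the trace makes
  \<open>L z\<close> skew for the Killing form \<open>K\<close>.\<close>

lemma trace_ad_ad_prod: "tr (\<lambda>v. [x, [y \<bullet> z, v]\<^sub>L]\<^sub>L) = 0"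
proof -
  define K where "K x y = tr (\<lambda>v. [x, [y, v]\<^sub>L]\<^sub>L)" for x y
  have K_skew: "K (z \<bullet> x) y = - K x (z \<bullet> y)" for x y z
  proof -
    have ad: "[z \<bullet> x, v]\<^sub>L = z \<bullet> [x, v]\<^sub>L - [x, z \<bullet> v]\<^sub>L" for x v
      by (simp add: prod_bracket_right)
    have "K (z \<bullet> x) y + K x (z \<bullet> y)
        = tr (\<lambda>v. z \<bullet> [x, [y, v]\<^sub>L]\<^sub>L) - tr (\<lambda>v. [x, [y, z \<bullet> v]\<^sub>L]\<^sub>L)"
      unfolding K_def ad by (simp add: tr_add[symmetric] tr_diff[symmetric] bilinear_simps)
    also have "\<dots> = 0"
      using tr_commute[of "\<lambda>v. z \<bullet> v" "\<lambda>v. [x, [y, v]\<^sub>L]\<^sub>L"] by (simp add: endo_ops endo_comp)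
    finally show ?thesis by (simp add: eq_neg_iff_add_eq_0)
  qed
  have K_sym: "K x y = K y x" for x y
    unfolding K_def by (rule tr_commute) (fact endo_ops)+
  have T: "K x (y \<bullet> z) = - K y (x \<bullet> z)" for x y z
    using K_skew[of z x y] K_sym by (simp add: prod_commute)
  \<comment> \<open>Three skew exchanges, alternating with the symmetry of the product, return to
    the start with sign -1.\<close>
  have "K x (y \<bullet> z) = - K x (y \<bullet> z)"
    using T[of x y z] T[of y z x] T[of z x y] by (simp add: prod_commute)
  then show ?thesis
    by (simp add: K_def)
qed

text \<open>For a bracket in the first slot, cyclicity and the derivation rule reduce the trace to
  that of \<open>ad w \<circ> ad (y \<bullet> x)\<close>, up to sign.\<close>

lemma trace_ad_prod: "tr (\<lambda>v. [x, y \<bullet> v]\<^sub>L) = 0"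
  using perfect
proof (induction x rule: perfect_induct)
  case subspace
  show ?case
    by (rule subspaceI) (simp_all add: bilinear_simps tr_add tr_scale, simp add: trace_def representation_zero)
next
  case (bracket w x)
  have "tr (\<lambda>v. [[w, x]\<^sub>L, y \<bullet> v]\<^sub>L)
      = tr (\<lambda>v. [w, [x, y \<bullet> v]\<^sub>L]\<^sub>L) - tr (\<lambda>v. [x, [w, y \<bullet> v]\<^sub>L]\<^sub>L)"
    by (simp add: bracket_bracket_left tr_diff)
  also have "tr (\<lambda>v. [x, [w, y \<bullet> v]\<^sub>L]\<^sub>L) = tr (\<lambda>v. [w, y \<bullet> [x, v]\<^sub>L]\<^sub>L)"
    using tr_commute[of "\<lambda>v. [x, v]\<^sub>L" "\<lambda>v. [w, y \<bullet> v]\<^sub>L"] by (simp add: endo_ops endo_comp)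
  also have "tr (\<lambda>v. [w, [x, y \<bullet> v]\<^sub>L]\<^sub>L) - tr (\<lambda>v. [w, y \<bullet> [x, v]\<^sub>L]\<^sub>L) = - tr (\<lambda>v. [w, [y \<bullet> x, v]\<^sub>L]\<^sub>L)"
    by (simp add: prod_bracket_right bilinear_simps tr_add)
  finally show ?case
    by (simp add: trace_ad_ad_prod)
qed

text \<open>The value \<open>G x [y, z]\<close> is computed twice. Since \<open>L\<close> is a
  representation it is invariant under cyclic permutation (\<open>G_cyc\<close>); the mixed formula
  for \<open>L [y, z]\<close> writes it through \<open>T\<close> (\<open>G_T\<close>), where the
  cyclic sum cancels by \<open>T_sym\<close>. So three times the value is 0.\<close>

lemma trace_prod_prod: "tr (\<lambda>v. x \<bullet> (y \<bullet> v)) = 0"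
  using perfect
proof (induction y rule: perfect_induct)
  case subspace
  show ?case
    by (rule subspaceI) (simp_all add: bilinear_simps tr_add tr_scale, simp add: trace_def representation_zero)
next
  case (bracket y z)
  define G where "G x y = tr (\<lambda>v. x \<bullet> (y \<bullet> v))" for x y
  define T where "T x y z = tr (\<lambda>v. [x, y \<bullet> (z \<bullet> v)]\<^sub>L)" for x y z
  have T_sym: "T x y z = T x z y" for x y z
    using trace_ad_prod[of x "[y, z]\<^sub>L"]
    by (simp add: T_def prod_bracket_left bilinear_simps tr_diff)
  have G_T: "G x [y, z]\<^sub>L = T y z x - T z y x" for x y z
    using tr_commute[of "\<lambda>v. x \<bullet> v" "\<lambda>v. [y, z \<bullet> v]\<^sub>L"] tr_commute[of "\<lambda>v. x \<bullet> v" "\<lambda>v. [z, y \<bullet> v]\<^sub>L"]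
    by (simp add: G_def T_def prod_bracket_left' bilinear_simps tr_diff endo_ops endo_comp)
  have G_cyc: "G x [y, z]\<^sub>L = G z [x, y]\<^sub>L" for x y z
    using tr_commute[of "\<lambda>v. z \<bullet> v" "\<lambda>v. x \<bullet> (y \<bullet> v)"] tr_commute[of "\<lambda>v. z \<bullet> (y \<bullet> v)" "\<lambda>v. x \<bullet> v"]
      tr_commute[of "\<lambda>v. z \<bullet> v" "\<lambda>v. y \<bullet> (x \<bullet> v)"]
    by (simp add: G_def prod_bracket_left bilinear_simps tr_diff endo_ops endo_comp)
  have "G x [y, z]\<^sub>L + G z [x, y]\<^sub>L + G y [z, x]\<^sub>L = 0"
    unfolding G_T by (simp add: T_sym[of x y z] T_sym[of y z x] T_sym[of z x y])
  then have "3 * G x [y, z]\<^sub>L = 0"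
    using G_cyc[of x y z] G_cyc[of z x y] by simp
  then show ?case
    by (simp add: G_def)
qed

end

section \<open>Nilpotency of the multiplications\<close>

text \<open>Because \<open>L\<close> is a representation, \<open>x\<close> acts on the product by a
  Leibniz rule, with \<open>ad x\<close> on the first factor and \<open>L x\<close> on the second;
  so eigenvalues add.\<close>

lemma prod_geig:
  assumes "y \<in> geig (\<lambda>z. [x, z]\<^sub>L) c" "v \<in> geig (\<lambda>z. x \<bullet> z) d"
  shows "y \<bullet> v \<in> geig (\<lambda>z. x \<bullet> z) (c + d)"
  using assms
  by (intro geig_bilinear[where f = "(\<bullet>)" and S = "\<lambda>z. [x, z]\<^sub>L" and T = "\<lambda>z. x \<bullet> z"] endo_ops)
    (simp_all add: prod_bracket_left)

lemma prod_nilpotent: "v \<in> geig (\<lambda>z. x \<bullet> z) 0"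
proof -
  let ?L = "\<lambda>z. x \<bullet> z" and ?ad = "\<lambda>z. [x, z]\<^sub>L"
  obtain B e where B: "independent B" "span B = UNIV" and e: "\<And>b. b \<in> B \<Longrightarrow> b \<in> geig ?L (e b)"
    and tri: "\<And>b. b \<in> B \<Longrightarrow> shift ?L (e b) b \<in> span (B - {b})"
    using triangular_basis[OF endo_prod(1), of x] by blast
  have fin: "finite B"
    using finiteI_independent B(1) by blast
  \<comment> \<open>The semisimple part of \<open>L x\<close> with conjugated eigenvalues, so that \<open>tr (D \<circ> L x)\<close> is the sum of
    the \<open>\<bar>e b\<bar>\<^sup>2\<close>. It scales each \<open>ad x\<close>-eigenspace of \<open>L \<gg>\<close>, hence \<open>[D, L \<gg>] \<subseteq> L \<gg>\<close>.\<close>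
  define D where "D = diag_op B (\<lambda>b. cnj (e b))"
  have endo_D: "endo D"
    unfolding D_def by (rule endo_diag_op[OF B])
  have D: "D v = cnj c *s v" if "v \<in> geig ?L c" for v c
    unfolding D_def using diag_op_geig[OF endo_prod(1) B fin e that] .
  have comm: "D (y \<bullet> v) = y \<bullet> D v + cnj c *s (y \<bullet> v)" if y: "y \<in> geig ?ad c" for y v c
  proof -
    have "v \<in> span B"
      using B by simp
    then show ?thesis
    proof (induction rule: span_induct_alt)
      case base
      show ?case by (simp add: bilinear_simps endo_zero[OF endo_D])
    next
      case (step a b v)
      \<comment> \<open>\<open>y \<bullet> b\<close> belongs to the eigenvalue
        \<open>c + e b\<close>, and conjugation is additive.\<close>
      have "D (y \<bullet> b) = y \<bullet> D b + cnj c *s (y \<bullet> b)"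
        using D[OF prod_geig[OF y e]] D[OF e] step.hyps
        by (simp add: bilinear_simps scale_left_distrib add.commute)
      then show ?case
        using step.IH by (simp add: bilinear_simps endo_add[OF endo_D] endo_scale[OF endo_D]
            scale_right_distrib scale_left_commute add_ac)
    qed
  qed
  \<comment> \<open>Only \<open>u = x\<close> is wanted; the claim for all \<open>u\<close> lets
    perfectness reduce it to brackets.\<close>
  have "trace B (\<lambda>v. D (u \<bullet> v)) = 0" for u
    using perfect
  proof (induction u rule: perfect_induct)
    case subspace
    show ?case
      by (rule subspaceI) (simp_all add: bilinear_simps endo_add[OF endo_D] endo_scale[OF endo_D]
          endo_zero[OF endo_D] trace_add[OF B] trace_scale[OF B], simp add: trace_def representation_zero)
  next
    case (bracket y z)
    have "y \<in> span (\<Union>c. geig ?ad c)"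
      using span_geig[OF endo_bracket(1)] by simp
    then show ?case
    proof (induction rule: span_induct_alt)
      case base
      show ?case
        by (simp add: bilinear_simps endo_zero[OF endo_D] trace_def representation_zero)
    next
      case (step a y u)
      then obtain c where c: "y \<in> geig ?ad c" by blast
      \<comment> \<open>Cyclicity leaves the trace of the commutator of \<open>D\<close> and
        \<open>L y\<close>, followed by \<open>L z\<close>; by \<open>comm\<close> this is
        \<open>cnj c\<close> times the trace of \<open>L y \<circ> L z\<close>, which is 0.\<close>
      have "trace B (\<lambda>v. D (z \<bullet> (y \<bullet> v))) = trace B (\<lambda>v. y \<bullet> D (z \<bullet> v))"
        using trace_comp_commute[OF B fin, of "\<lambda>v. D (z \<bullet> v)" "\<lambda>v. y \<bullet> v"]
        by (simp add: endo_prod endo_D endo_comp)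
      then have "trace B (\<lambda>v. D ([y, z]\<^sub>L \<bullet> v)) = 0"
        by (simp add: prod_bracket_left endo_diff[OF endo_D] comm[OF c] trace_add[OF B] trace_diff[OF B]
            trace_scale[OF B] trace_prod_prod[OF B])
      then show ?case
        using step.IH by (simp add: bilinear_simps endo_add[OF endo_D] endo_scale[OF endo_D]
            trace_add[OF B] trace_scale[OF B])
    qed
  qed
  then have "(\<Sum>b\<in>B. cnj (e b) * e b) = 0"
    using trace_diag_op_triangular[OF B fin tri, of "\<lambda>b. cnj (e b)"] by (simp add: D_def)
  then have "complex_of_real (\<Sum>b\<in>B. (cmod (e b))\<^sup>2) = 0"
    unfolding of_real_sum complex_norm_square by (simp add: mult.commute)
  then have "(\<Sum>b\<in>B. (cmod (e b))\<^sup>2) = 0"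
    unfolding of_real_eq_0_iff .
  then have "e b = 0" if "b \<in> B" for b
    using fin that by (simp add: sum_nonneg_eq_0_iff)
  then have "B \<subseteq> geig ?L 0"
    using e by (metis subsetI)
  then have "span B \<subseteq> geig ?L 0"
    by (rule span_minimal[OF _ subspace_geig[OF endo_prod(1)]])
  then show ?thesis
    using B(2) by auto
qed

text \<open>The kernel of the representation \<open>L\<close>; working modulo it replaces the Lie
  algebra \<open>L \<gg>\<close> of operators.\<close>

definition annihilator :: "'g set" where
  "annihilator = {y. \<forall>v. y \<bullet> v = 0}"

lemma ideal_annihilator: "ideal_of UNIV annihilator"
  by (auto simp: ideal_of_def annihilator_def bilinear_simps prod_bracket_left intro!: subspaceI)

text \<open>For \<open>c \<noteq> 0\<close>, products with \<open>geig (ad x) c\<close> would be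
  generalized eigenvectors of \<open>L x\<close> for \<open>c\<close>, but \<open>L x\<close> is
  nilpotent. So these eigenspaces lie in the annihilator, and on the remaining one
  \<open>ad x\<close> is nilpotent.\<close>

lemma ad_nilpotent_mod_annihilator: "\<exists>k. ((\<lambda>z. [x, z]\<^sub>L) ^^ k) y \<in> annihilator"
proof -
  let ?ad = "\<lambda>z. [x, z]\<^sub>L"
  have "u \<bullet> v = 0" if "c \<noteq> 0" "u \<in> geig ?ad c" for c u v
    by (rule geig_Int[OF endo_prod(1)[of x] that(1) _ prod_nilpotent])
      (use prod_geig[OF that(2) prod_nilpotent] in simp)
  then have "geig ?ad c \<subseteq> geig ?ad 0 \<union> annihilator" for c
    by (cases "c = 0") (auto simp: annihilator_def)
  then have "(\<Union>c. geig ?ad c) \<subseteq> geig ?ad 0 \<union> annihilator"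
    by (rule UN_least)
  then have "span (\<Union>c. geig ?ad c) \<subseteq> span (geig ?ad 0 \<union> annihilator)"
    by (rule span_mono)
  then have "y \<in> span (geig ?ad 0 \<union> annihilator)"
    unfolding span_geig[OF endo_bracket(1)] by blast
  moreover have "span (geig ?ad 0) = geig ?ad 0" "span annihilator = annihilator"
    using subspace_geig[OF endo_bracket(1)] ideal_annihilator by (simp_all add: ideal_of_def)
  ultimately obtain u w where y: "y = u + w" "u \<in> geig ?ad 0" "w \<in> annihilator"
    by (auto simp: span_Un)
  have "shift ?ad 0 = ?ad"
    by (auto simp: shift_def)
  then obtain k where "(?ad ^^ k) u = 0"
    using y(2) by (auto simp: geig_def)
  moreover have "(?ad ^^ k) w \<in> annihilator"
    using y(3) ideal_annihilator by (induction k) (auto simp: ideal_of_def)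
  ultimately have "(?ad ^^ k) y \<in> annihilator"
    by (simp add: y(1) endo_add[OF endo_funpow[OF endo_bracket(1)]])
  then show ?thesis ..
qed

theorem prod_trivial: "x \<bullet> y = 0"
proof -
  have "annihilator = UNIV"
    using perfect ideal_annihilator ad_nilpotent_mod_annihilator
    by (rule perfect_ad_nilpotent_mod_ideal)
  then show ?thesis
    by (auto simp: annihilator_def)
qed

end

theorem corollary5p12:
  fixes scale :: "complex \<Rightarrow> 'g::ab_group_add \<Rightarrow> 'g"
    and Basis :: "'g set"
    and bracket :: "'g \<Rightarrow> 'g \<Rightarrow> 'g"
    and \<aa> \<ss> :: "'g set"
    and p :: "'g \<Rightarrow> 'g \<Rightarrow> 'g"
  assumes "lie_algebra scale bracket"
    and "finite_dimensional_vector_space scale Basis"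
    and "lie_algebra.perfect scale bracket"
    and "lie_algebra.semidirect_product scale bracket \<aa> \<ss>"
    and "lie_algebra.semisimple scale bracket \<ss>"
    and "lie_algebra.is_solvable_radical scale bracket UNIV \<aa>"
    and "\<aa> \<noteq> {0}"
    and "lie_algebra.abelian bracket \<aa>"
    and "lie_algebra.irreducible_module scale bracket \<ss> \<aa>"
    and "lie_algebra.D011 scale bracket = {\<lambda>x. 0}"
    and "lie_algebra.commutative_post_lie scale bracket p"
  shows "\<forall>x y. p x y = 0"
proof -
  interpret lie_algebra scale bracket
    by fact
  interpret finite_dimensional_vector_space scale Basis
    by fact
  interpret perfect_cpa scale bracket Basis p
    by unfold_locales (use assms in simp_all)
  show ?thesis
    by (simp add: prod_trivial)
qed

end
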